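(* Let $\underline{B}=(B,\leq,0,1,+,C)$ be a contact join-semilattice. Then there is a nonempty set $W$ and an isomorphic embedding of $\underline{B}$ into the structure $(2^W,\subseteq,\emptyset,W,\cup,C_W)$, where $2^W$ is the set of all subsets of $W$ and $a\,C_W\,b$ iff $a\cap b\neq\emptyset$.
   Context: A contact join-semilattice (CJS) is a structure $(B,\leq,0,1,+,C)$ with $B$ a set, $0,1\in B$, $+$ a binary operation on $B$, and $\leq$, $C$ binary relations on $B$, satisfying for all elements: (1) $x\leq x$; (2) $x\leq y\wedge y\leq x\rightarrow x=y$; (3) $x\leq y\wedge y\leq z\rightarrow x\leq z$; (4) $x+y=y+x$; (5) $x\leq x+y$; (6) $x\leq z\wedge y\leq z\rightarrow x+y\leq z$; (7) $0\leq x$; (8) $x\leq 1$; (9) $xCy\rightarrow x\neq 0$; (10) $xCy\rightarrow yCx$; and, for all integers $m,i,n\geq 1$, the following axioms. (By (1)–(6), $x+y$ is the least upper bound of $x,y$, so finite joins are unambiguous.) $A^1_{m,i}$: for all $x,y$ and all $s_j^l,t_j^l$ ($1\leq j\leq m$, $1\leq l\leq i$): if $xCy$, and $x\leq s_j^1+\dots+s_j^i$ and $y\leq t_j^1+\dots+t_j^i$ for every $j=1,\dots,m$, then there are $l_1,\dots,l_m,k_1,\dots,k_m\in\{1,\dots,i\}$ such that $s_j^{l_j}Cs_u^{l_u}$ and $t_j^{k_j}Ct_u^{k_u}$ for all $1\leq j\leq u\leq m$, and $s_j^{l_j}Ct_u^{k_u}$ for all $j,u\in\{1,\dots,m\}$.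 $A_{n,i}$: for all $t,u$ and all $x_k^j$ ($1\leq k\leq n$, $1\leq j\leq i$): if $t\not\leq u$ and $t\leq x_k^1+\dots+x_k^i$ for every $k=1,\dots,n$, then there are $j_1,\dots,j_n\in\{1,\dots,i\}$ such that $x_k^{j_k}\not\leq u$ for all $k$ and $x_k^{j_k}Cx_l^{j_l}$ for all $k,l\in\{1,\dots,n\}$. An isomorphic embedding of $(B,\leq,0,1,+,C)$ into $(B',\leq',0',1',+',C')$ is an injective map $h:B\to B'$ with $h(0)=0'$, $h(1)=1'$, $h(a+b)=h(a)+'h(b)$, and $a\leq b\iff h(a)\leq' h(b)$, $aCb\iff h(a)C'h(b)$ for all $a,b$.
   Formalization: The formal theorem assumes in addition that 0 ≠ 1; the one-element structure with 0 = 1 and empty C satisfies all the axioms, but h(0) = ∅ and h(1) = W would force W to be empty. *)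

theory Defs
  imports "HOL-Library.FuncSet"
begin

record 'a contact_structure =
  Carr :: "'a set"
  Le :: "'a \<Rightarrow> 'a \<Rightarrow> bool"  (infix "\<sqsubseteq>\<index>" 50)
  Zero :: 'a  ("\<zero>\<index>")
  One :: 'a  ("\<one>\<index>")
  Join :: "'a \<Rightarrow> 'a \<Rightarrow> 'a"  (infixl "\<oplus>\<index>" 65)
  Cont :: "'a \<Rightarrow> 'a \<Rightarrow> bool"  (infix "\<frown>\<index>" 50)

text \<open>
  For \<open>i \<ge> 1\<close>, \<open>Joins B f i\<close> is the left-nested join \<open>f 1 \<oplus> f 2 \<oplus> \<dots> \<oplus> f i\<close>.  The value at
  \<open>i = 0\<close> is a dummy: it does not enter the later joins and is never used in the axioms.
\<close>
primrec Joins :: "('a, 'm) contact_structure_scheme \<Rightarrow> (nat \<Rightarrow> 'a) \<Rightarrow> nat \<Rightarrow> 'a" where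
  "Joins B f 0 = \<zero>\<^bsub>B\<^esub>"
| "Joins B f (Suc i) = (if i = 0 then f 1 else Joins B f i \<oplus>\<^bsub>B\<^esub> f (Suc i))"

text \<open>
  The axiom \<open>A\<^sup>1\<close> with parameters \<open>m\<close>, \<open>i\<close>; the value \<open>s j l\<close> stands for the element with lower
  index \<open>j\<close> and upper index \<open>l\<close>, and likewise \<open>t j l\<close>.
\<close>
definition contact_axiom1 :: "('a, 'm) contact_structure_scheme \<Rightarrow> nat \<Rightarrow> nat \<Rightarrow> bool" where
  "contact_axiom1 B m i \<longleftrightarrow>
     (\<forall>x\<in>Carr B. \<forall>y\<in>Carr B. \<forall>s t :: nat \<Rightarrow> nat \<Rightarrow> 'a.
        (\<forall>j\<in>{1..m}. \<forall>l\<in>{1..i}. s j l \<in> Carr B \<and> t j l \<in> Carr B) \<longrightarrow>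
        x \<frown>\<^bsub>B\<^esub> y \<longrightarrow>
        (\<forall>j\<in>{1..m}. x \<sqsubseteq>\<^bsub>B\<^esub> Joins B (s j) i \<and> y \<sqsubseteq>\<^bsub>B\<^esub> Joins B (t j) i) \<longrightarrow>
        (\<exists>l k :: nat \<Rightarrow> nat.
           (\<forall>j\<in>{1..m}. l j \<in> {1..i} \<and> k j \<in> {1..i}) \<and>
           (\<forall>j\<in>{1..m}. \<forall>u\<in>{j..m}. s j (l j) \<frown>\<^bsub>B\<^esub> s u (l u) \<and> t j (k j) \<frown>\<^bsub>B\<^esub> t u (k u)) \<and>
           (\<forall>j\<in>{1..m}. \<forall>u\<in>{1..m}. s j (l j) \<frown>\<^bsub>B\<^esub> t u (k u))))"

text \<open>
  The axiom \<open>A\<close> with parameters \<open>n\<close>, \<open>i\<close>; the value \<open>x k j\<close> stands for the element with lower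
  index \<open>k\<close> and upper index \<open>j\<close>.
\<close>
definition contact_axiom2 :: "('a, 'm) contact_structure_scheme \<Rightarrow> nat \<Rightarrow> nat \<Rightarrow> bool" where
  "contact_axiom2 B n i \<longleftrightarrow>
     (\<forall>t\<in>Carr B. \<forall>u\<in>Carr B. \<forall>x :: nat \<Rightarrow> nat \<Rightarrow> 'a.
        (\<forall>k\<in>{1..n}. \<forall>j\<in>{1..i}. x k j \<in> Carr B) \<longrightarrow>
        \<not> t \<sqsubseteq>\<^bsub>B\<^esub> u \<longrightarrow>
        (\<forall>k\<in>{1..n}. t \<sqsubseteq>\<^bsub>B\<^esub> Joins B (x k) i) \<longrightarrow>
        (\<exists>j :: nat \<Rightarrow> nat.
           (\<forall>k\<in>{1..n}. j k \<in> {1..i}) \<and>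
           (\<forall>k\<in>{1..n}. \<not> x k (j k) \<sqsubseteq>\<^bsub>B\<^esub> u) \<and>
           (\<forall>k\<in>{1..n}. \<forall>l\<in>{1..n}. x k (j k) \<frown>\<^bsub>B\<^esub> x l (j l))))"

text \<open>
  The axioms admit the one-element structure with \<open>\<zero> = \<one>\<close> and empty contact.  It embeds only
  into the powerset structure over \<open>{}\<close>, so a representation over a nonempty set needs \<open>\<zero> \<noteq> \<one>\<close>.
\<close>
locale contact_join_semilattice =
  fixes B :: "('a, 'm) contact_structure_scheme"  (structure)
  assumes zero_closed: "\<zero> \<in> Carr B"
    and one_closed: "\<one> \<in> Carr B"
    and join_closed: "\<lbrakk>x \<in> Carr B; y \<in> Carr B\<rbrakk> \<Longrightarrow> x \<oplus> y \<in> Carr B"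
    and le_refl: "x \<in> Carr B \<Longrightarrow> x \<sqsubseteq> x"
    and le_antisym: "\<lbrakk>x \<in> Carr B; y \<in> Carr B; x \<sqsubseteq> y; y \<sqsubseteq> x\<rbrakk> \<Longrightarrow> x = y"
    and le_trans: "\<lbrakk>x \<in> Carr B; y \<in> Carr B; z \<in> Carr B; x \<sqsubseteq> y; y \<sqsubseteq> z\<rbrakk> \<Longrightarrow> x \<sqsubseteq> z"
    and join_comm: "\<lbrakk>x \<in> Carr B; y \<in> Carr B\<rbrakk> \<Longrightarrow> x \<oplus> y = y \<oplus> x"
    and join_upper: "\<lbrakk>x \<in> Carr B; y \<in> Carr B\<rbrakk> \<Longrightarrow> x \<sqsubseteq> x \<oplus> y"
    and join_least:
      "\<lbrakk>x \<in> Carr B; y \<in> Carr B; z \<in> Carr B; x \<sqsubseteq> z; y \<sqsubseteq> z\<rbrakk> \<Longrightarrow> x \<oplus> y \<sqsubseteq> z"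
    and zero_least: "x \<in> Carr B \<Longrightarrow> \<zero> \<sqsubseteq> x"
    and one_greatest: "x \<in> Carr B \<Longrightarrow> x \<sqsubseteq> \<one>"
    and cont_nonzero: "\<lbrakk>x \<in> Carr B; y \<in> Carr B; x \<frown> y\<rbrakk> \<Longrightarrow> x \<noteq> \<zero>"
    and cont_sym: "\<lbrakk>x \<in> Carr B; y \<in> Carr B; x \<frown> y\<rbrakk> \<Longrightarrow> y \<frown> x"
    and axiom1: "\<lbrakk>1 \<le> m; 1 \<le> i\<rbrakk> \<Longrightarrow> contact_axiom1 B m i"
    and axiom2: "\<lbrakk>1 \<le> n; 1 \<le> i\<rbrakk> \<Longrightarrow> contact_axiom2 B n i"

definition isomorphic_embedding ::
  "('a \<Rightarrow> 'b) \<Rightarrow> ('a, 'm) contact_structure_scheme \<Rightarrow> ('b, 'n) contact_structure_scheme \<Rightarrow> bool"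
where
  "isomorphic_embedding h B B' \<longleftrightarrow>
     h \<in> Carr B \<rightarrow> Carr B' \<and>
     inj_on h (Carr B) \<and>
     h \<zero>\<^bsub>B\<^esub> = \<zero>\<^bsub>B'\<^esub> \<and>
     h \<one>\<^bsub>B\<^esub> = \<one>\<^bsub>B'\<^esub> \<and>
     (\<forall>a\<in>Carr B. \<forall>b\<in>Carr B. h (a \<oplus>\<^bsub>B\<^esub> b) = h a \<oplus>\<^bsub>B'\<^esub> h b) \<and>
     (\<forall>a\<in>Carr B. \<forall>b\<in>Carr B. a \<sqsubseteq>\<^bsub>B\<^esub> b \<longleftrightarrow> h a \<sqsubseteq>\<^bsub>B'\<^esub> h b) \<and>
     (\<forall>a\<in>Carr B. \<forall>b\<in>Carr B. a \<frown>\<^bsub>B\<^esub> b \<longleftrightarrow> h a \<frown>\<^bsub>B'\<^esub> h b)"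

definition powerset_structure :: "'w set \<Rightarrow> 'w set contact_structure" where
  "powerset_structure W =
     \<lparr>Carr = Pow W, Le = (\<subseteq>), Zero = {}, One = W, Join = (\<union>),
      Cont = (\<lambda>a b. a \<inter> b \<noteq> {})\<rparr>"

text \<open>
  HOL cannot quantify existentially over types, so a representing set \<open>W\<close> has to live in a fixed
  type.  For a structure over \<open>'a\<close> the type \<open>'a set\<close> loses nothing: an embedding \<open>h\<close> into
  \<open>powerset_structure W\<close>, with \<open>W\<close> in any type, yields one into the powerset structure over
  \<open>{{a \<in> Carr B. w \<in> h a} |w. w \<in> W}\<close>.
\<close>

end

theory Submission
  imports Defs
begin

text \<open>
  Represent \<open>a\<close> by the set of all clans containing it, a clan being a nonempty set of elements
  pairwise (and each with itself) in contact whose complement is an ideal.  Each of the two axiom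
  schemes says that some ideal \<open>J\<close> is \<^emph>\<open>good\<close>: from finitely many finite covers of the given
  elements one can select members outside \<open>J\<close> that are pairwise in contact.  Goodness passes to
  unions of chains, because only finitely many elements of the union matter for given covers.
  If \<open>J\<close> is a maximal good ideal and \<open>a \<notin> J\<close>, then some covers witness that the ideal generated
  by \<open>J\<close> and \<open>a\<close> is not good; replacing in them each \<open>x \<le> j + a\<close> by \<open>j\<close> and \<open>a\<close> yields covers from
  which every admissible selection contains \<open>a\<close>.  Doing this for \<open>a\<close> and \<open>b\<close> simultaneously shows
  that \<open>a\<close> and \<open>b\<close> are in contact, so the complement of \<open>J\<close> is a clan.
\<close>

section \<open>Finite enumerations and iterated joins\<close>

text \<open>The axioms index all families by one common range, while covers differ in size. A
  bijection from \<open>{1..card A}\<close> is therefore padded with a fixed element of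
  \<open>A\<close>; this is why \<open>A\<close> must be nonempty.\<close>

lemma finite_enumeration_from_1:
  assumes "finite A" "A \<noteq> {}" "card A \<le> n"
  shows "\<exists>g :: nat \<Rightarrow> 'b. g ` {1..n} = A"
proof -
  obtain f where f: "bij_betw f {1..card A} A"
    using assms(1) ex_bij_betw_nat_finite_1 by blast
  obtain a where a: "a \<in> A" using assms(2) by blast
  define g where "g k = (if k \<le> card A then f k else a)" for k
  have "g ` {1..card A} = A"
    using f by (auto simp: g_def bij_betw_def)
  moreover have "g ` {1..card A} \<subseteq> g ` {1..n}" using assms(3) by auto
  moreover have "g k \<in> A" if "k \<in> {1..n}" for k
    using that a f by (auto simp: g_def bij_betw_def)
  ultimately show ?thesis by blast
qed

context contact_join_semilattice
begin

lemma join_upper2: "\<lbrakk>x \<in> Carr B; y \<in> Carr B\<rbrakk> \<Longrightarrow> y \<sqsubseteq> x \<oplus> y"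
  using join_comm join_upper by metis

lemma Joins_closed:
  "\<forall>k\<in>{1..i}. f k \<in> Carr B \<Longrightarrow> Joins B f i \<in> Carr B"
  by (induction i) (auto simp: zero_closed intro: join_closed)

lemma Joins_upper:
  "\<lbrakk>\<forall>k\<in>{1..i}. f k \<in> Carr B; k \<in> {1..i}\<rbrakk> \<Longrightarrow> f k \<sqsubseteq> Joins B f i"
proof (induction i)
  case (Suc i)
  show ?case
  proof (cases "i = 0")
    case True
    then show ?thesis using Suc.prems le_refl by (cases "k = 1") auto
  next
    case False
    have c: "Joins B f i \<in> Carr B" using Suc.prems by (auto intro: Joins_closed)
    have d: "f (Suc i) \<in> Carr B" using Suc.prems by auto
    show ?thesis
    proof (cases "k = Suc i")
      case True
      then show ?thesis using False c d join_upper2 by simp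
    next
      case k: False
      then have "f k \<sqsubseteq> Joins B f i" using Suc by auto
      moreover have "f k \<in> Carr B" using Suc.prems by auto
      ultimately have "f k \<sqsubseteq> Joins B f i \<oplus> f (Suc i)"
        using le_trans[OF _ c join_closed[OF c d]] join_upper[OF c d] by blast
      then show ?thesis using False by simp
    qed
  qed
qed simp

text \<open>Since \<open>Joins\<close> is a least upper bound, this says \<open>t \<sqsubseteq> x\<^sub>1 \<oplus> \<dots> \<oplus> x\<^sub>i\<close> for \<open>X = {x\<^sub>1, \<dots>, x\<^sub>i}\<close>.\<close>
definition covers :: "'a set \<Rightarrow> 'a \<Rightarrow> bool" where
  "covers X t \<longleftrightarrow> finite X \<and> X \<subseteq> Carr B \<and> (\<forall>z\<in>Carr B. (\<forall>x\<in>X. x \<sqsubseteq> z) \<longrightarrow> t \<sqsubseteq> z)"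

section \<open>Ideals, cliques and goodness\<close>

definition ideal :: "'a set \<Rightarrow> bool" where
  "ideal J \<longleftrightarrow> J \<subseteq> Carr B \<and> \<zero> \<in> J \<and>
     (\<forall>x\<in>J. \<forall>y\<in>J. x \<oplus> y \<in> J) \<and> (\<forall>x\<in>Carr B. \<forall>y\<in>J. x \<sqsubseteq> y \<longrightarrow> x \<in> J)"

definition clique :: "'a set \<Rightarrow> bool" where
  "clique Y \<longleftrightarrow> (\<forall>x\<in>Y. \<forall>y\<in>Y. x \<frown> y)"

text \<open>A selection is encoded by the set \<open>Y\<close> of its values instead of a choice
  function, so \<open>Y\<close> may meet a cover in several elements. The bound
  \<open>Y \<subseteq> \<Union>K\<close> confines \<open>Y\<close> to a finite set, which the chain
  argument relies on.\<close>

definition good :: "'a set \<Rightarrow> 'a set \<Rightarrow> bool" where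
  "good T J \<longleftrightarrow> (\<forall>K. finite K \<longrightarrow> (\<forall>X\<in>K. \<exists>t\<in>T. covers X t) \<longrightarrow>
     (\<exists>Y\<subseteq>\<Union>K. clique Y \<and> Y \<inter> J = {} \<and> (\<forall>X\<in>K. X \<inter> Y \<noteq> {})))"

lemma clique_mono: "\<lbrakk>clique Y; Z \<subseteq> Y\<rbrakk> \<Longrightarrow> clique Z"
  unfolding clique_def by blast

text \<open>The bound on \<open>Y\<close> comes for free: intersecting a clique with
  \<open>\<Union>K\<close> keeps it a clique disjoint from \<open>J\<close> that still meets every
  member of \<open>K\<close>.\<close>

lemma goodI:
  assumes "\<And>K. \<lbrakk>finite K; \<forall>X\<in>K. \<exists>t\<in>T. covers X t\<rbrakk> \<Longrightarrow>
    \<exists>Y. clique Y \<and> Y \<inter> J = {} \<and> (\<forall>X\<in>K. X \<inter> Y \<noteq> {})"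
  shows "good T J"
  unfolding good_def
proof (intro allI impI)
  fix K assume K: "finite K" "\<forall>X\<in>K. \<exists>t\<in>T. covers X t"
  obtain Y where Y: "clique Y" "Y \<inter> J = {}" "\<forall>X\<in>K. X \<inter> Y \<noteq> {}"
    using assms[OF K] by blast
  show "\<exists>Y\<subseteq>\<Union>K. clique Y \<and> Y \<inter> J = {} \<and> (\<forall>X\<in>K. X \<inter> Y \<noteq> {})"
    by (rule exI[of _ "Y \<inter> \<Union>K"]) (use Y clique_mono[of Y "Y \<inter> \<Union>K"] in blast)
qed

lemma goodE:
  assumes "good T J" "finite K" "\<And>X. X \<in> K \<Longrightarrow> \<exists>t\<in>T. covers X t"
  obtains Y where "Y \<subseteq> \<Union>K" "clique Y" "Y \<inter> J = {}" "\<And>X. X \<in> K \<Longrightarrow> X \<inter> Y \<noteq> {}"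
proof -
  have "\<exists>Y\<subseteq>\<Union>K. clique Y \<and> Y \<inter> J = {} \<and> (\<forall>X\<in>K. X \<inter> Y \<noteq> {})"
    using assms by (auto simp only: good_def)
  then show thesis using that by auto
qed

lemma not_goodE:
  assumes "\<not> good T J"
  obtains K where "finite K" "\<forall>X\<in>K. \<exists>t\<in>T. covers X t"
    "\<nexists>Y. clique Y \<and> Y \<inter> J = {} \<and> (\<forall>X\<in>K. X \<inter> Y \<noteq> {})"
  proof (rule ccontr)
  assume no: "\<not> thesis"
  have "good T J"
    by (rule goodI, rule ccontr, rule notE[OF no], rule that)
  then show False using assms by simp
qed

lemma covers_self: "t \<in> Carr B \<Longrightarrow> covers {t} t"
  by (auto simp: covers_def)

lemma covers_Joins:
  assumes "covers X t" "f ` {1..i} = X"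
  shows "t \<sqsubseteq> Joins B f i"
proof -
  have c: "\<forall>k\<in>{1..i}. f k \<in> Carr B" using assms by (auto simp: covers_def)
  have "\<forall>x\<in>X. x \<sqsubseteq> Joins B f i" unfolding assms(2)[symmetric] using Joins_upper[OF c] by simp
  then show ?thesis using assms(1) Joins_closed[OF c] by (auto simp: covers_def)
qed

text \<open>Every element is an upper bound of the empty set, in particular \<open>\<zero>\<close>,
  so the empty set can cover only \<open>\<zero>\<close>.\<close>

lemma covers_nonempty:
  assumes "covers X t" "t \<in> Carr B" "t \<noteq> \<zero>"
  shows "X \<noteq> {}"
  using assms zero_closed zero_least le_antisym by (auto simp: covers_def)

section \<open>Generated ideals and unions of chains\<close>

text \<open>Bounds \<open>j \<oplus> a\<close> and \<open>k \<oplus> a\<close> with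
  \<open>j\<close>, \<open>k\<close> in \<open>J\<close> both lie below
  \<open>j \<oplus> k \<oplus> a\<close>, where \<open>j \<oplus> k\<close> is again in
  \<open>J\<close>.\<close>

lemma ideal_generated:
  assumes "ideal J" "a \<in> Carr B"
  shows "ideal {x \<in> Carr B. \<exists>j\<in>J. x \<sqsubseteq> j \<oplus> a}"
  unfolding ideal_def
proof (intro conjI ballI impI)
  have J: "J \<subseteq> Carr B" "\<zero> \<in> J" using assms by (auto simp: ideal_def)
  show "\<zero> \<in> {x \<in> Carr B. \<exists>j\<in>J. x \<sqsubseteq> j \<oplus> a}"
    using J assms zero_closed zero_least[OF join_closed[OF zero_closed assms(2)]] by blast
  fix x y assume x: "x \<in> {x \<in> Carr B. \<exists>j\<in>J. x \<sqsubseteq> j \<oplus> a}"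
    and y: "y \<in> {x \<in> Carr B. \<exists>j\<in>J. x \<sqsubseteq> j \<oplus> a}"
  obtain j k where j: "j \<in> J" "x \<sqsubseteq> j \<oplus> a" and k: "k \<in> J" "y \<sqsubseteq> k \<oplus> a" using x y by auto
  have c: "x \<in> Carr B" "y \<in> Carr B" "j \<in> Carr B" "k \<in> Carr B" using x y j k J by auto
  have jk: "j \<oplus> k \<in> J" using assms(1) j k by (auto simp: ideal_def)
  have cl: "j \<oplus> k \<in> Carr B" "j \<oplus> k \<oplus> a \<in> Carr B" "j \<oplus> a \<in> Carr B" "k \<oplus> a \<in> Carr B"
    using c assms(2) join_closed by auto
  have "j \<sqsubseteq> j \<oplus> k \<oplus> a" "k \<sqsubseteq> j \<oplus> k \<oplus> a" "a \<sqsubseteq> j \<oplus> k \<oplus> a"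
    using c cl assms(2) join_upper join_upper2 le_trans by metis+
  then have "j \<oplus> a \<sqsubseteq> j \<oplus> k \<oplus> a" "k \<oplus> a \<sqsubseteq> j \<oplus> k \<oplus> a"
    using c cl assms(2) join_least by auto
  then have "x \<sqsubseteq> j \<oplus> k \<oplus> a" "y \<sqsubseteq> j \<oplus> k \<oplus> a"
    using c cl j k le_trans by metis+
  then have "x \<oplus> y \<sqsubseteq> j \<oplus> k \<oplus> a" using c cl join_least by auto
  then show "x \<oplus> y \<in> {x \<in> Carr B. \<exists>j\<in>J. x \<sqsubseteq> j \<oplus> a}" using jk c join_closed by auto
next
  fix x y assume x: "x \<in> Carr B" and y: "y \<in> {x \<in> Carr B. \<exists>j\<in>J. x \<sqsubseteq> j \<oplus> a}" and le: "x \<sqsubseteq> y"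
  obtain j where j: "j \<in> J" "y \<sqsubseteq> j \<oplus> a" using y by auto
  have "j \<oplus> a \<in> Carr B" using j assms join_closed by (auto simp: ideal_def)
  then have "x \<sqsubseteq> j \<oplus> a" using x y le j le_trans by blast
  then show "x \<in> {x \<in> Carr B. \<exists>j\<in>J. x \<sqsubseteq> j \<oplus> a}" using x j by auto
qed auto

lemma ideal_principal: "u \<in> Carr B \<Longrightarrow> ideal {x \<in> Carr B. x \<sqsubseteq> u}"
  unfolding ideal_def
  by (auto simp: zero_closed zero_least join_closed intro: join_least le_trans)

lemma ideal_Union_chain:
  assumes "\<C> \<noteq> {}" "subset.chain {J. ideal J} \<C>"
  shows "ideal (\<Union>\<C>)"
proof -
  have i: "ideal J" if "J \<in> \<C>" for J using assms that by (auto simp: subset.chain_def)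
  have "x \<oplus> y \<in> \<Union>\<C>" if xy: "x \<in> \<Union>\<C>" "y \<in> \<Union>\<C>" for x y
  proof -
    obtain J where J: "J \<in> \<C>" "{x, y} \<subseteq> J"
      by (rule finite_subset_Union_chain[OF _ _ assms, of "{x, y}"]) (use xy in auto)
    then have "x \<oplus> y \<in> J" using i[of J] by (auto simp: ideal_def)
    then show ?thesis using J by blast
  qed
  moreover have "x \<in> \<Union>\<C>" if "x \<in> Carr B" "y \<in> \<Union>\<C>" "x \<sqsubseteq> y" for x y
    using that i unfolding ideal_def by (meson UnionE UnionI)
  moreover have "\<zero> \<in> \<Union>\<C>" "\<Union>\<C> \<subseteq> Carr B"
    using i assms(1) unfolding ideal_def by blast+
  ultimately show ?thesis unfolding ideal_def by simp
qed

lemma good_Union_chain: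
  assumes "\<C> \<noteq> {}" "subset.chain {J. good T J} \<C>"
  shows "good T (\<Union>\<C>)"
proof (rule goodI)
  fix K assume K: "finite K" "\<forall>X\<in>K. \<exists>t\<in>T. covers X t"
  \<comment> \<open>This finite part of the union already lies in a single member \<open>J\<close>
    of the chain. A selection inside \<open>\<Union>K\<close> that avoids \<open>J\<close> therefore
    avoids the whole union.\<close>
  have fin: "finite (\<Union>K \<inter> \<Union>\<C>)" using K by (auto simp: covers_def)
  obtain J where J: "J \<in> \<C>" "\<Union>K \<inter> \<Union>\<C> \<subseteq> J"
    by (rule finite_subset_Union_chain[OF fin _ assms]) auto
  have "good T J" using J assms by (auto simp: subset.chain_def)
  then obtain Y where Y: "Y \<subseteq> \<Union>K" "clique Y" "Y \<inter> J = {}" "\<forall>X\<in>K. X \<inter> Y \<noteq> {}"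
    using K by (elim goodE[where K = K]) auto
  then show "\<exists>Y. clique Y \<and> Y \<inter> \<Union>\<C> = {} \<and> (\<forall>X\<in>K. X \<inter> Y \<noteq> {})"
    using J(2) by (intro exI[of _ Y]) blast
qed

section \<open>Clans from maximal good ideals\<close>

lemma forcing_covers:
  assumes J: "ideal J" and a: "a \<in> Carr B"
    and ng: "\<not> good T {x \<in> Carr B. \<exists>j\<in>J. x \<sqsubseteq> j \<oplus> a}"
  shows "\<exists>K. finite K \<and> (\<forall>X\<in>K. \<exists>t\<in>T. covers X t) \<and>
    (\<forall>Y. clique Y \<longrightarrow> Y \<inter> J = {} \<longrightarrow> (\<forall>X\<in>K. X \<inter> Y \<noteq> {}) \<longrightarrow> a \<in> Y)"
proof -
  define I where "I = {x \<in> Carr B. \<exists>j\<in>J. x \<sqsubseteq> j \<oplus> a}"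
  obtain K where K: "finite K" "\<forall>X\<in>K. \<exists>t\<in>T. covers X t"
    and no: "\<nexists>Y. clique Y \<and> Y \<inter> I = {} \<and> (\<forall>X\<in>K. X \<inter> Y \<noteq> {})"
    using not_goodE[OF ng[folded I_def]] .
  have "\<forall>x\<in>I. \<exists>j. j \<in> J \<and> x \<sqsubseteq> j \<oplus> a" by (auto simp: I_def)
  then obtain j where j: "\<And>x. x \<in> I \<Longrightarrow> j x \<in> J \<and> x \<sqsubseteq> j x \<oplus> a" by metis
  \<comment> \<open>An upper bound of \<open>r X\<close> bounds \<open>j x \<oplus> a\<close>, hence
    also each replaced \<open>x\<close>; so \<open>r X\<close> covers whatever \<open>X\<close>
    covers. No distributivity is involved.\<close>
  define r where "r X = insert a ((X - I) \<union> j ` (X \<inter> I))" for X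
  have JB: "J \<subseteq> Carr B" using J by (auto simp: ideal_def)
  have cov: "covers (r X) t" if X: "covers X t" for X t
    unfolding covers_def
  proof (intro conjI ballI impI)
    show "finite (r X)" using X by (auto simp: covers_def r_def)
    show "r X \<subseteq> Carr B" using X a j JB by (auto simp: covers_def r_def)
    fix z assume z: "z \<in> Carr B" and ub: "\<forall>x\<in>r X. x \<sqsubseteq> z"
    have "x \<sqsubseteq> z" if x: "x \<in> X" for x
    proof (cases "x \<in> I")
      case True
      then have jx: "j x \<in> Carr B" "x \<sqsubseteq> j x \<oplus> a" "x \<in> Carr B" using j JB by (auto simp: I_def)
      have "j x \<oplus> a \<sqsubseteq> z" using ub True x jx a z by (intro join_least) (auto simp: r_def)
      then show ?thesis using jx a z join_closed le_trans by blast
    qed (use ub x in \<open>auto simp: r_def\<close>)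
    then show "t \<sqsubseteq> z" using X z by (auto simp: covers_def)
  qed
  have "a \<in> Y" if Y: "clique Y" "Y \<inter> J = {}" "\<forall>X\<in>r ` K. X \<inter> Y \<noteq> {}" for Y
  proof (rule ccontr)
    assume n: "a \<notin> Y"
    have "\<forall>X\<in>K. X \<inter> (Y - I) \<noteq> {}"
    proof
      fix X assume "X \<in> K"
      then obtain y where y: "y \<in> r X" "y \<in> Y" using Y(3) by blast
      \<comment> \<open>The other members of \<open>r X\<close> are \<open>a\<close>, which is not
        in \<open>Y\<close>, and values of \<open>j\<close>, which lie in \<open>J\<close>. Hence
        \<open>Y - I\<close> would be a selection from \<open>K\<close> avoiding \<open>I\<close>,
        contrary to the choice of \<open>K\<close>.\<close>
      then have "y \<in> X - I" using n Y(2) j by (auto simp: r_def)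
      then show "X \<inter> (Y - I) \<noteq> {}" using y by blast
    qed
    moreover have "clique (Y - I)" using Y(1) by (rule clique_mono) blast
    ultimately show False using no by blast
  qed
  then show ?thesis using K cov by (intro exI[of _ "r ` K"]) blast
qed

text \<open>The condition on the complement says at once that \<open>\<Gamma>\<close> is upward
  closed, omits \<open>\<zero>\<close>, and contains one of two elements whenever it contains their
  join. Nonemptiness puts \<open>\<one>\<close> into every clan.\<close>

definition clan :: "'a set \<Rightarrow> bool" where
  "clan \<Gamma> \<longleftrightarrow> \<Gamma> \<subseteq> Carr B \<and> \<Gamma> \<noteq> {} \<and> clique \<Gamma> \<and> ideal (Carr B - \<Gamma>)"

lemma good_ideal_imp_clan:
  assumes T: "T \<subseteq> Carr B" "T \<noteq> {}" and J0: "ideal J0" "good T J0"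
  shows "\<exists>\<Gamma>. clan \<Gamma> \<and> T \<subseteq> \<Gamma> \<and> \<Gamma> \<inter> J0 = {}"
proof -
  let ?A = "{J. ideal J \<and> good T J \<and> J0 \<subseteq> J}"
  have "\<exists>M\<in>?A. \<forall>J\<in>?A. M \<subseteq> J \<longrightarrow> J = M"
  proof (rule subset_Zorn_nonempty)
    show "?A \<noteq> {}" using J0 by blast
    fix \<C> assume C: "\<C> \<noteq> {}" "subset.chain ?A \<C>"
    then have "subset.chain {J. ideal J} \<C>" "subset.chain {J. good T J} \<C>"
      by (auto simp: subset.chain_def)
    then have "ideal (\<Union>\<C>)" "good T (\<Union>\<C>)"
      using C(1) ideal_Union_chain good_Union_chain by blast+
    moreover have "J0 \<subseteq> \<Union>\<C>" using C by (fastforce simp: subset.chain_def)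
    ultimately show "\<Union>\<C> \<in> ?A" by blast
  qed
  then obtain M where M: "ideal M" "good T M" "J0 \<subseteq> M"
    and max0: "\<forall>J\<in>?A. M \<subseteq> J \<longrightarrow> J = M" by auto
  have max: "J = M" if "ideal J" "good T J" "M \<subseteq> J" for J
    using max0 that M(3) by simp
  have MB: "M \<subseteq> Carr B" "\<zero> \<in> M" using M by (auto simp: ideal_def)
  have force: "\<exists>K. finite K \<and> (\<forall>X\<in>K. \<exists>t\<in>T. covers X t) \<and>
    (\<forall>Y. clique Y \<longrightarrow> Y \<inter> M = {} \<longrightarrow> (\<forall>X\<in>K. X \<inter> Y \<noteq> {}) \<longrightarrow> a \<in> Y)"
    if a: "a \<in> Carr B" "a \<notin> M" for a
  proof -
    let ?I = "{x \<in> Carr B. \<exists>j\<in>M. x \<sqsubseteq> j \<oplus> a}"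
    have "M \<subseteq> ?I" using MB a join_upper by blast
    moreover have "a \<in> ?I" using MB a join_upper2[of "\<zero>" a] by blast
    \<comment> \<open>Otherwise maximality would give \<open>?I = M\<close>, although
      \<open>a\<close> lies only in \<open>?I\<close>.\<close>
    ultimately have "\<not> good T ?I" using max[of ?I] ideal_generated[OF M(1) a(1)] a(2) by blast
    from forcing_covers[OF M(1) a(1) this] show ?thesis .
  qed
  have cl: "a \<frown> b" if "a \<in> Carr B - M" "b \<in> Carr B - M" for a b
  proof -
    have a: "a \<in> Carr B" "a \<notin> M" using that(1) by simp_all
    obtain K where K: "finite K" "\<forall>X\<in>K. \<exists>t\<in>T. covers X t"
      "\<forall>Y. clique Y \<longrightarrow> Y \<inter> M = {} \<longrightarrow> (\<forall>X\<in>K. X \<inter> Y \<noteq> {}) \<longrightarrow> a \<in> Y"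
      using force[OF a] by (elim exE conjE)
    have b: "b \<in> Carr B" "b \<notin> M" using that(2) by simp_all
    obtain L where L: "finite L" "\<forall>X\<in>L. \<exists>t\<in>T. covers X t"
      "\<forall>Y. clique Y \<longrightarrow> Y \<inter> M = {} \<longrightarrow> (\<forall>X\<in>L. X \<inter> Y \<noteq> {}) \<longrightarrow> b \<in> Y"
      using force[OF b] by (elim exE conjE)
    \<comment> \<open>One selection for both families must contain \<open>a\<close> and
      \<open>b\<close>, and its members are pairwise in contact.\<close>
    have "finite (K \<union> L)" "\<forall>X\<in>K \<union> L. \<exists>t\<in>T. covers X t" using K L by auto
    then obtain Y where Y: "clique Y" "Y \<inter> M = {}" "\<forall>X\<in>K \<union> L. X \<inter> Y \<noteq> {}"
      using goodE[OF M(2), of "K \<union> L"] by metis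
    then have "a \<in> Y" "b \<in> Y" using K(3) L(3) by simp_all
    then show ?thesis using Y(1) by (auto simp: clique_def)
  qed
  have TM: "t \<notin> M" if t: "t \<in> T" for t
  proof -
    \<comment> \<open>The only possible selection from the singleton cover is \<open>t\<close>
      itself, so goodness keeps \<open>t\<close> out of \<open>M\<close>.\<close>
    have "finite {{t}}" "\<forall>X\<in>{{t}}. \<exists>t\<in>T. covers X t" using t T covers_self by auto
    then obtain Y where "Y \<inter> M = {}" "\<forall>X\<in>{{t}}. X \<inter> Y \<noteq> {}"
      using goodE[OF M(2), of "{{t}}"] by metis
    then show ?thesis by auto
  qed
  have "Carr B - (Carr B - M) = M" using MB by blast
  then have "clan (Carr B - M)" using cl M(1) TM T unfolding clan_def clique_def by auto
  then show ?thesis using TM T M(3) by (intro exI[of _ "Carr B - M"]) blast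
qed

section \<open>Goodness from the two axiom schemes\<close>

text \<open>This is scheme \<open>contact_axiom2\<close> with one row per cover of \<open>t\<close>;
  the chosen entries, one from each row, form the clique.\<close>

lemma good_principal:
  assumes tu: "t \<in> Carr B" "u \<in> Carr B" "\<not> t \<sqsubseteq> u"
  shows "good {t} {x \<in> Carr B. x \<sqsubseteq> u}"
proof (rule goodI)
  fix K assume K: "finite K" "\<forall>X\<in>K. \<exists>t'\<in>{t}. covers X t'"
  \<comment> \<open>The extra cover guarantees \<open>1 \<le> n\<close> and \<open>1 \<le> i\<close>
    even when \<open>K\<close> is empty.\<close>
  define L where "L = insert {t} K"
  have L: "finite L" "L \<noteq> {}" "\<And>X. X \<in> L \<Longrightarrow> covers X t"
    using K tu covers_self by (auto simp: L_def)
  have "t \<noteq> \<zero>" using tu zero_least by blast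
  then have ne: "X \<noteq> {}" if "X \<in> L" for X using that covers_nonempty L tu by blast
  define n where "n = card L"
  \<comment> \<open>A common row length: no cover in \<open>L\<close> has more elements than the
    union, and shorter covers are listed with repetitions.\<close>
  define i where "i = card (\<Union>L)"
  have finU: "finite (\<Union>L)" using L by (auto simp: covers_def)
  have n1: "1 \<le> n" using L by (simp add: n_def Suc_le_eq card_gt_0_iff)
  have i1: "1 \<le> i" using finU by (auto simp: i_def L_def Suc_le_eq card_gt_0_iff)
  obtain E where E: "E ` {1..n} = L"
    using finite_enumeration_from_1[OF L(1,2)] n_def by blast
  have "\<exists>g. g ` {1..i} = X" if "X \<in> L" for X :: "'a set"
    using that L ne[OF that] finU card_mono[OF finU, of X]
    by (intro finite_enumeration_from_1) (auto simp: i_def covers_def)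
  then obtain G where G: "\<And>X. X \<in> L \<Longrightarrow> G X ` {1..i} = X" by metis
  define x where "x k = G (E k)" for k
  have EL: "E k \<in> L" if "k \<in> {1..n}" for k using E that by blast
  have x: "x k ` {1..i} = E k" if "k \<in> {1..n}" for k using G EL that by (simp add: x_def)
  have xE: "x k j \<in> E k" if "k \<in> {1..n}" "j \<in> {1..i}" for k j using x that by blast
  have xB: "\<forall>k\<in>{1..n}. \<forall>j\<in>{1..i}. x k j \<in> Carr B"
    using xE EL L(3) unfolding covers_def by blast
  have le: "\<forall>k\<in>{1..n}. t \<sqsubseteq> Joins B (x k) i" using covers_Joins L(3) EL x by blast
  have "\<exists>j :: nat \<Rightarrow> nat. (\<forall>k\<in>{1..n}. j k \<in> {1..i}) \<and> (\<forall>k\<in>{1..n}. \<not> x k (j k) \<sqsubseteq> u) \<and>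
    (\<forall>k\<in>{1..n}. \<forall>l\<in>{1..n}. x k (j k) \<frown> x l (j l))"
    by (rule axiom2[OF n1 i1, unfolded contact_axiom2_def, THEN bspec[OF _ tu(1)],
          THEN bspec[OF _ tu(2)], THEN spec[of _ x], THEN mp, THEN mp, THEN mp])
      (fact xB tu(3) le)+
  then obtain j where j: "\<forall>k\<in>{1..n}. j k \<in> {1..i}" "\<forall>k\<in>{1..n}. \<not> x k (j k) \<sqsubseteq> u"
    "\<forall>k\<in>{1..n}. \<forall>l\<in>{1..n}. x k (j k) \<frown> x l (j l)"
    by (elim exE conjE)
  let ?Y = "(\<lambda>k. x k (j k)) ` {1..n}"
  have "clique ?Y" using j(3) by (auto simp: clique_def)
  moreover have "?Y \<inter> {x \<in> Carr B. x \<sqsubseteq> u} = {}" using j(2) by auto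
  moreover have "X \<inter> ?Y \<noteq> {}" if X: "X \<in> K" for X
  proof -
    obtain k where "k \<in> {1..n}" "X = E k" using X E unfolding L_def by blast
    then show ?thesis using xE j(1) by blast
  qed
  ultimately show "\<exists>Y. clique Y \<and> Y \<inter> {x \<in> Carr B. x \<sqsubseteq> u} = {} \<and> (\<forall>X\<in>K. X \<inter> Y \<noteq> {})" by blast
qed

text \<open>This is scheme \<open>contact_axiom1\<close>, with the covers of \<open>x\<close> as the
  rows \<open>s\<close> and those of \<open>y\<close> as the rows \<open>t\<close>. A cover of both
  elements occurs in both lists, which does no harm since it only has to be met once.\<close>

lemma good_zero:
  assumes xy: "x \<in> Carr B" "y \<in> Carr B" "x \<frown> y"
  shows "good {x, y} {\<zero>}"
proof (rule goodI)
  fix K assume K: "finite K" "\<forall>X\<in>K. \<exists>t\<in>{x, y}. covers X t"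
  define P where "P = insert {x} {X \<in> K. covers X x}"
  define Q where "Q = insert {y} {X \<in> K. covers X y}"
  have P: "finite P" "P \<noteq> {}" "\<And>X. X \<in> P \<Longrightarrow> covers X x"
    using K xy covers_self by (auto simp: P_def)
  have Q: "finite Q" "Q \<noteq> {}" "\<And>X. X \<in> Q \<Longrightarrow> covers X y"
    using K xy covers_self by (auto simp: Q_def)
  have "x \<noteq> \<zero>" "y \<noteq> \<zero>" using xy cont_nonzero cont_sym by blast+
  then have ne: "X \<noteq> {}" if "X \<in> P \<union> Q" for X using that covers_nonempty P Q xy by blast
  \<comment> \<open>Both lists must have the same number of rows; the sum bounds each cardinality,
    and repeated rows fill the gap.\<close>
  define m where "m = card P + card Q"
  define i where "i = card (\<Union>(P \<union> Q))"
  have finU: "finite (\<Union>(P \<union> Q))" using P Q by (auto simp: covers_def)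
  have m1: "1 \<le> m" using P by (simp add: m_def Suc_le_eq card_gt_0_iff)
  have i1: "1 \<le> i" using finU by (auto simp: i_def P_def Suc_le_eq card_gt_0_iff)
  obtain E where E: "E ` {1..m} = P"
    using finite_enumeration_from_1[OF P(1,2), of m] m_def by auto
  obtain F where F: "F ` {1..m} = Q"
    using finite_enumeration_from_1[OF Q(1,2), of m] m_def by auto
  have "\<exists>g. g ` {1..i} = X" if "X \<in> P \<union> Q" for X :: "'a set"
    using that P(3)[of X] Q(3)[of X] ne[OF that] card_mono[OF finU, of X]
    by (intro finite_enumeration_from_1) (auto simp: i_def covers_def)
  then obtain G where G: "\<And>X. X \<in> P \<union> Q \<Longrightarrow> G X ` {1..i} = X" by metis
  define s where "s k = G (E k)" for k
  define t where "t k = G (F k)" for k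
  have EP: "E k \<in> P" and FQ: "F k \<in> Q" if "k \<in> {1..m}" for k using E F that by blast+
  have s: "s k ` {1..i} = E k" and t: "t k ` {1..i} = F k" if "k \<in> {1..m}" for k
    using G EP FQ that by (simp_all add: s_def t_def)
  have sE: "s k j \<in> E k" and tF: "t k j \<in> F k" if "k \<in> {1..m}" "j \<in> {1..i}" for k j
    using s t that by blast+
  have sB: "s k j \<in> Carr B" and tB: "t k j \<in> Carr B" if "k \<in> {1..m}" "j \<in> {1..i}" for k j
    using sE[OF that] tF[OF that] P(3)[OF EP[OF that(1)]] Q(3)[OF FQ[OF that(1)]]
    by (auto simp: covers_def)
  have le: "x \<sqsubseteq> Joins B (s k) i" "y \<sqsubseteq> Joins B (t k) i" if "k \<in> {1..m}" for k
    using covers_Joins[OF P(3)[OF EP[OF that]] s[OF that]]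
      covers_Joins[OF Q(3)[OF FQ[OF that]] t[OF that]] .
  have ex: "\<exists>l k :: nat \<Rightarrow> nat.
           (\<forall>j\<in>{1..m}. l j \<in> {1..i} \<and> k j \<in> {1..i}) \<and>
           (\<forall>j\<in>{1..m}. \<forall>u\<in>{j..m}. s j (l j) \<frown> s u (l u) \<and> t j (k j) \<frown> t u (k u)) \<and>
           (\<forall>j\<in>{1..m}. \<forall>u\<in>{1..m}. s j (l j) \<frown> t u (k u))"
    by (rule axiom1[OF m1 i1, unfolded contact_axiom1_def, THEN bspec[OF _ xy(1)],
          THEN bspec[OF _ xy(2)], THEN spec[of _ s], THEN spec[of _ t], THEN mp, THEN mp, THEN mp])
      (intro ballI conjI sB tB le xy(3); assumption)+
  obtain l k :: "nat \<Rightarrow> nat" where lk: "\<And>j. j \<in> {1..m} \<Longrightarrow> l j \<in> {1..i} \<and> k j \<in> {1..i}"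
    "\<And>j u. \<lbrakk>j \<in> {1..m}; u \<in> {j..m}\<rbrakk> \<Longrightarrow> s j (l j) \<frown> s u (l u) \<and> t j (k j) \<frown> t u (k u)"
    "\<And>j u. \<lbrakk>j \<in> {1..m}; u \<in> {1..m}\<rbrakk> \<Longrightarrow> s j (l j) \<frown> t u (k u)"
    using ex by blast
  have lB: "s j (l j) \<in> Carr B" and kB: "t j (k j) \<in> Carr B" if "j \<in> {1..m}" for j
    using sB tB lk(1) that by blast+
  \<comment> \<open>Within \<open>s\<close> and within \<open>t\<close> the axiom gives contact only
    for \<open>j \<le> u\<close>; symmetry supplies the other pairs.\<close>
  have st: "s j (l j) \<frown> s u (l u) \<and> t j (k j) \<frown> t u (k u)" if "j \<in> {1..m}" "u \<in> {1..m}" for j u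
  proof (cases "j \<le> u")
    case True
    then show ?thesis using lk(2) that by simp
  next
    case False
    then have "s u (l u) \<frown> s j (l j) \<and> t u (k u) \<frown> t j (k j)" using lk(2) that by simp
    then show ?thesis using cont_sym lB kB that by blast
  qed
  let ?Y = "(\<lambda>j. s j (l j)) ` {1..m} \<union> (\<lambda>j. t j (k j)) ` {1..m}"
  have ts: "t u (k u) \<frown> s j (l j)" if "j \<in> {1..m}" "u \<in> {1..m}" for j u
    using cont_sym[OF lB kB lk(3)] that by simp
  have clq: "clique ?Y"
    unfolding clique_def
  proof (intro ballI)
    fix v w assume "v \<in> ?Y" "w \<in> ?Y"
    then show "v \<frown> w"
      by (elim UnE imageE) (simp_all only: st ts lk(3))
  qed
  \<comment> \<open>Members of a clique are in contact with themselves, which \<open>\<zero>\<close>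
    is not.\<close>
  have "\<zero> \<notin> ?Y"
    using clq cont_nonzero[OF zero_closed zero_closed] unfolding clique_def by metis
  then have "?Y \<inter> {\<zero>} = {}" by (simp only: disjoint_insert) simp
  moreover have "\<forall>X\<in>K. X \<inter> ?Y \<noteq> {}"
  proof
    fix X assume X: "X \<in> K"
    consider "X \<in> P" | "X \<in> Q" using X K(2) by (auto simp: P_def Q_def)
    then show "X \<inter> ?Y \<noteq> {}"
    proof cases
      case 1
      then obtain j where "j \<in> {1..m}" "X = E j" using E by blast
      then show ?thesis using sE lk(1) by blast
    next
      case 2
      then obtain j where "j \<in> {1..m}" "X = F j" using F by blast
      then show ?thesis using tF lk(1) by blast
    qed
  qed
  ultimately show "\<exists>Y. clique Y \<and> Y \<inter> {\<zero>} = {} \<and> (\<forall>X\<in>K. X \<inter> Y \<noteq> {})"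
    using clq by (intro exI[of _ ?Y] conjI)
qed

section \<open>Clans represent order, joins and contact\<close>

lemma ideal_zero: "ideal {\<zero>}"
proof -
  have "{x \<in> Carr B. x \<sqsubseteq> \<zero>} = {\<zero>}"
    using zero_closed zero_least le_antisym by blast
  then show ?thesis using ideal_principal[OF zero_closed] by simp
qed

lemma clan_join:
  assumes "clan \<Gamma>" "a \<in> Carr B" "b \<in> Carr B"
  shows "a \<oplus> b \<in> \<Gamma> \<longleftrightarrow> a \<in> \<Gamma> \<or> b \<in> \<Gamma>"
proof -
  have "ideal (Carr B - \<Gamma>)" using assms by (simp add: clan_def)
  then show ?thesis
    using assms join_closed join_upper join_upper2 unfolding ideal_def by (metis DiffD2 DiffI)
qed

lemma clan_mono:
  assumes "clan \<Gamma>" "a \<in> \<Gamma>" "b \<in> Carr B" "a \<sqsubseteq> b"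
  shows "b \<in> \<Gamma>"
  using assms unfolding clan_def ideal_def by blast

text \<open>If \<open>a\<close> is not below \<open>b\<close>, the principal ideal of
  \<open>b\<close> is good for \<open>{a}\<close>, and the resulting clan contains \<open>a\<close>
  but avoids that ideal and hence \<open>b\<close>.\<close>

lemma le_iff_clans:
  assumes "a \<in> Carr B" "b \<in> Carr B"
  shows "a \<sqsubseteq> b \<longleftrightarrow> (\<forall>\<Gamma>. clan \<Gamma> \<longrightarrow> a \<in> \<Gamma> \<longrightarrow> b \<in> \<Gamma>)"
proof
  show "\<forall>\<Gamma>. clan \<Gamma> \<longrightarrow> a \<in> \<Gamma> \<longrightarrow> b \<in> \<Gamma>" if "a \<sqsubseteq> b"
    using that assms clan_mono by blast
  show "a \<sqsubseteq> b" if R: "\<forall>\<Gamma>. clan \<Gamma> \<longrightarrow> a \<in> \<Gamma> \<longrightarrow> b \<in> \<Gamma>"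
  proof (rule ccontr)
    assume "\<not> a \<sqsubseteq> b"
    then obtain \<Gamma> where "clan \<Gamma>" "a \<in> \<Gamma>" "\<Gamma> \<inter> {x \<in> Carr B. x \<sqsubseteq> b} = {}"
      using good_ideal_imp_clan[of "{a}"] ideal_principal[of b] good_principal[of a b] assms by auto
    then show False using R assms le_refl by blast
  qed
qed

text \<open>Contact makes \<open>{\<zero>}\<close> good for \<open>{a, b}\<close>, which yields a
  clan through both; conversely a clan is a clique.\<close>

lemma cont_iff_clan:
  assumes "a \<in> Carr B" "b \<in> Carr B"
  shows "a \<frown> b \<longleftrightarrow> (\<exists>\<Gamma>. clan \<Gamma> \<and> a \<in> \<Gamma> \<and> b \<in> \<Gamma>)"
proof
  show "\<exists>\<Gamma>. clan \<Gamma> \<and> a \<in> \<Gamma> \<and> b \<in> \<Gamma>" if "a \<frown> b"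
    using good_ideal_imp_clan[OF _ _ ideal_zero good_zero[OF assms that]] assms by auto
qed (auto simp: clan_def clique_def)

lemma clan_zero_one:
  assumes "clan \<Gamma>"
  shows "\<zero> \<notin> \<Gamma>" "\<one> \<in> \<Gamma>"
proof -
  show "\<zero> \<notin> \<Gamma>" using assms by (auto simp: clan_def ideal_def)
  obtain a where "a \<in> \<Gamma>" "a \<in> Carr B" using assms by (auto simp: clan_def)
  then show "\<one> \<in> \<Gamma>" using assms clan_mono one_closed one_greatest by blast
qed

end

theorem mainTheorem1:
  fixes B :: "'a contact_structure"
  assumes "contact_join_semilattice B"
    and "\<zero>\<^bsub>B\<^esub> \<noteq> \<one>\<^bsub>B\<^esub>"
  shows "\<exists>(W :: 'a set set) h. W \<noteq> {} \<and> isomorphic_embedding h B (powerset_structure W)"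
proof -
  interpret contact_join_semilattice B by (rule assms(1))
  define W where "W = {\<Gamma>. clan \<Gamma>}"
  define h where "h a = {\<Gamma> \<in> W. a \<in> \<Gamma>}" for a
  have le: "a \<sqsubseteq>\<^bsub>B\<^esub> b \<longleftrightarrow> h a \<subseteq> h b" if "a \<in> Carr B" "b \<in> Carr B" for a b
    using le_iff_clans[OF that] by (auto simp: h_def W_def)
  have "\<not> \<one>\<^bsub>B\<^esub> \<sqsubseteq>\<^bsub>B\<^esub> \<zero>\<^bsub>B\<^esub>"
    using assms(2) le_antisym zero_least zero_closed one_closed by blast
  \<comment> \<open>Since \<open>\<one>\<close> is not below \<open>\<zero>\<close>, some clan must
    separate them.\<close>
  then have "W \<noteq> {}" using le[OF one_closed zero_closed] by (auto simp: h_def)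
  moreover have "inj_on h (Carr B)"
    using le by (intro inj_onI le_antisym) simp_all
  moreover have "h (a \<oplus>\<^bsub>B\<^esub> b) = h a \<union> h b" if "a \<in> Carr B" "b \<in> Carr B" for a b
    using clan_join that by (auto simp: h_def W_def)
  moreover have "a \<frown>\<^bsub>B\<^esub> b \<longleftrightarrow> h a \<inter> h b \<noteq> {}" if "a \<in> Carr B" "b \<in> Carr B" for a b
    using cont_iff_clan[OF that] by (auto simp: h_def W_def)
  moreover have "h \<zero>\<^bsub>B\<^esub> = {}" "h \<one>\<^bsub>B\<^esub> = W"
    using clan_zero_one by (auto simp: h_def W_def)
  moreover have "h \<in> Carr B \<rightarrow> Pow W" by (auto simp: h_def)
  ultimately have "W \<noteq> {} \<and> isomorphic_embedding h B (powerset_structure W)"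
    using le by (simp add: isomorphic_embedding_def powerset_structure_def)
  then show ?thesis by blast
qed

end
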